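(* For every integer $k \ge 2$, $f(2,k) = \frac{k}{2^{k-1}}$.
   Context: For an integer $s\ge 1$ let $\Sigma_s=\{0,1,\ldots,s-1\}$ with its natural total order. An $n$-word over $\Sigma_s$ is a sequence $w=(w_1,\ldots,w_n)\in(\Sigma_s)^n$. A subword is a subsequence $w_{i_1}w_{i_2}\cdots w_{i_k}$ with $i_1<\cdots<i_k$ (subsequences at different position sets are counted as different); it is monotone if it is non-decreasing or non-increasing. Let $m(k,w)$ be the number of monotone $k$-subwords of $w$, let $f(s,k,n)=\min_{w\in(\Sigma_s)^n} m(k,w)/\binom{n}{k}$, and let $f(s,k)=\lim_{n\to\infty} f(s,k,n)$ (this limit exists). *)

theory Defs
  imports Complex_Main
begin

definition words :: "nat \<Rightarrow> nat \<Rightarrow> nat list set" where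
  "words s n = {w. length w = n \<and> set w \<subseteq> {0..<s}}"

definition monotone_word :: "nat list \<Rightarrow> bool" where
  "monotone_word u \<longleftrightarrow> sorted_wrt (\<le>) u \<or> sorted_wrt (\<ge>) u"

text \<open>Subwords are counted by their position sets, so equal subsequences occurring at
  different positions count separately. Positions are numbered from 0.\<close>

definition monotone_subwords :: "nat \<Rightarrow> nat list \<Rightarrow> nat" where
  "monotone_subwords k w =
     card {I. I \<subseteq> {0..<length w} \<and> card I = k \<and> monotone_word (nths w I)}"

text \<open>For n < k the quotient is 0 / 0 = 0; this affects only finitely many n.\<close>

definition min_density :: "nat \<Rightarrow> nat \<Rightarrow> nat \<Rightarrow> real" where
  "min_density s k n =
     Min ((\<lambda>w. real (monotone_subwords k w) / real (n choose k)) ` words s n)"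

definition limit_density :: "nat \<Rightarrow> nat \<Rightarrow> real" where
  "limit_density s k = lim (\<lambda>n. min_density s k n)"

end

theory Submission
  imports Defs
begin

text \<open>
  For a position \<open>i\<close> of a binary word let \<open>D i\<close> be the set of the zeros before \<open>i\<close> and the ones
  after \<open>i\<close>, and \<open>E i\<close> the set of the ones before \<open>i\<close> and the zeros after \<open>i\<close>. If \<open>I\<close> is a set
  of positions, \<open>i \<in> I\<close> and \<open>I - {i}\<close> lies in \<open>D i\<close> or in \<open>E i\<close>, then \<open>I\<close> is monotone; conversely
  every monotone \<open>I\<close> arises in this way exactly twice (from the two positions at which
  the letter changes or, if it is constant, from its two ends). Hence twice the number of monotone \<open>k\<close>-subwords is
  \<open>\<Sum>i<n. (card (D i) choose (k - 1)) + (card (E i) choose (k - 1))\<close>, where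
  \<open>card (D i) + card (E i) = n - 1\<close>. By convexity each summand is minimal when the two cardinalities
  differ by at most one, and for the alternating word this happens at every \<open>i\<close> simultaneously.
\<close>

section \<open>Counting monotone sets of positions by their pivots\<close>

definition up_on :: "(nat \<Rightarrow> bool) \<Rightarrow> nat set \<Rightarrow> bool" where
  "up_on P I \<longleftrightarrow> (\<forall>i\<in>I. \<forall>j\<in>I. i < j \<longrightarrow> P i \<longrightarrow> P j)"

text \<open>With \<open>P\<close> saying that the letter is 1, this is the set \<open>D i\<close>
  from above; with \<open>P\<close> negated it is \<open>E i\<close>. Neither contains
  \<open>i\<close>, and the letter at \<open>i\<close> itself is irrelevant.\<close>

definition up_nbrs :: "nat \<Rightarrow> (nat \<Rightarrow> bool) \<Rightarrow> nat \<Rightarrow> nat set" where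
  "up_nbrs n P i = {j. j < n \<and> (j < i \<and> \<not> P j \<or> i < j \<and> P j)}"

lemma finite_up_nbrs [simp]: "finite (up_nbrs n P i)"
  unfolding up_nbrs_def by (rule finite_subset[of _ "{..<n}"]) auto

lemma card_up_nbrs_compl:
  assumes "i < n"
  shows "card (up_nbrs n P i) + card (up_nbrs n (\<lambda>j. \<not> P j) i) = n - 1"
proof -
  have "up_nbrs n P i \<union> up_nbrs n (\<lambda>j. \<not> P j) i = {..<n} - {i}"
    unfolding up_nbrs_def by auto
  moreover have "up_nbrs n P i \<inter> up_nbrs n (\<lambda>j. \<not> P j) i = {}"
    unfolding up_nbrs_def by auto
  ultimately have "card (up_nbrs n P i) + card (up_nbrs n (\<lambda>j. \<not> P j) i) = card ({..<n} - {i})"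
    by (metis card_Un_disjoint finite_up_nbrs)
  then show ?thesis using assms by simp
qed

text \<open>Call \<open>i\<close> a pivot of \<open>I\<close> if \<open>I - {i}\<close> lies in
  \<open>up_nbrs n P i\<close>. If the zeros of \<open>I\<close> all precede its ones, the pivots
  are exactly the last zero and the first one, as far as these exist; otherwise there is
  none.\<close>

lemma card_pivots:
  assumes I: "I \<subseteq> {..<n}"
  shows "card {i\<in>I. I - {i} \<subseteq> up_nbrs n P i} =
    (if up_on P I then (if \<exists>i\<in>I. \<not> P i then 1 else 0) + (if \<exists>i\<in>I. P i then 1 else 0) else 0)"
proof (cases "up_on P I")
  case False
  then obtain a b where ab: "a \<in> I" "b \<in> I" "a < b" "P a" "\<not> P b"
    unfolding up_on_def by blast
  \<comment> \<open>A pivot would have to lie at or before the one at \<open>a\<close> and at or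
    after the zero at \<open>b\<close>, but \<open>a < b\<close>.\<close>
  have "\<not> I - {i} \<subseteq> up_nbrs n P i" if "i \<in> I" for i
  proof
    assume "I - {i} \<subseteq> up_nbrs n P i"
    then have "a = i \<or> a \<in> up_nbrs n P i" "b = i \<or> b \<in> up_nbrs n P i" using ab by auto
    then show False using ab unfolding up_nbrs_def by auto
  qed
  then have "{i\<in>I. I - {i} \<subseteq> up_nbrs n P i} = {}" by auto
  then show ?thesis using False by (simp only: card.empty if_False)
next
  case True
  have fin: "finite I" using I finite_subset by blast
  let ?Z = "{i\<in>I. \<not> P i}" and ?O = "{i\<in>I. P i}"
  let ?A = "{i\<in>I. \<not> P i \<and> I - {i} \<subseteq> up_nbrs n P i}"
  let ?B = "{i\<in>I. P i \<and> I - {i} \<subseteq> up_nbrs n P i}"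
  have A: "?A = {Max ?Z}" if "?Z \<noteq> {}"
  proof (intro set_eqI iffI)
    fix i assume "i \<in> ?A"
    then have i: "i \<in> I" "\<not> P i" "\<And>j. j \<in> I \<Longrightarrow> j \<noteq> i \<Longrightarrow> j \<in> up_nbrs n P i" by auto
    have "Max ?Z = i"
      by (rule Max_eqI) (use fin i in \<open>auto simp: up_nbrs_def\<close>, metis linorder_le_cases order_le_less)
    then show "i \<in> {Max ?Z}" by simp
  next
    fix i assume "i \<in> {Max ?Z}"
    then have i: "i \<in> ?Z" and mx: "\<And>j. j \<in> ?Z \<Longrightarrow> j \<le> i"
      using Max_in[of ?Z] Max_ge[of ?Z] fin that by auto
    have "j \<in> up_nbrs n P i" if "j \<in> I" "j \<noteq> i" for j
    proof (cases "j < i")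
      case j: True
      then have "\<not> P j" using True that i unfolding up_on_def by blast
      then show ?thesis using j that I unfolding up_nbrs_def by auto
    next
      case False
      then have j: "i < j" using that by simp
      then have "P j" using mx[of j] that by auto
      then show ?thesis using j that I unfolding up_nbrs_def by auto
    qed
    then show "i \<in> ?A" using i by auto
  qed
  have B: "?B = {Min ?O}" if "?O \<noteq> {}"
  proof (intro set_eqI iffI)
    fix i assume "i \<in> ?B"
    then have i: "i \<in> I" "P i" "\<And>j. j \<in> I \<Longrightarrow> j \<noteq> i \<Longrightarrow> j \<in> up_nbrs n P i" by auto
    have "Min ?O = i"
      by (rule Min_eqI) (use fin i in \<open>auto simp: up_nbrs_def\<close>, metis linorder_le_cases order_le_less)
    then show "i \<in> {Min ?O}" by simp
  next
    fix i assume "i \<in> {Min ?O}"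
    then have i: "i \<in> ?O" and mn: "\<And>j. j \<in> ?O \<Longrightarrow> i \<le> j"
      using Min_in[of ?O] Min_le[of ?O] fin that by auto
    have "j \<in> up_nbrs n P i" if "j \<in> I" "j \<noteq> i" for j
    proof (cases "j < i")
      case j: True
      then have "\<not> P j" using mn[of j] that by auto
      then show ?thesis using j that I unfolding up_nbrs_def by auto
    next
      case False
      then have j: "i < j" using that by simp
      then have "P j" using True that i unfolding up_on_def by blast
      then show ?thesis using j that I unfolding up_nbrs_def by auto
    qed
    then show "i \<in> ?B" using i by auto
  qed
  have "{i\<in>I. I - {i} \<subseteq> up_nbrs n P i} = ?A \<union> ?B" by blast
  moreover have "card (?A \<union> ?B) = card ?A + card ?B"
    by (rule card_Un_disjoint) (use fin in auto)
  moreover have "card ?A = (if \<exists>i\<in>I. \<not> P i then 1 else 0)"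
  proof (cases "?Z = {}")
    case True
    then have "?A = {}" by blast
    then show ?thesis using True by (auto simp only: card.empty split: if_splits)
  next
    case False
    then show ?thesis using A[OF False] by auto
  qed
  moreover have "card ?B = (if \<exists>i\<in>I. P i then 1 else 0)"
  proof (cases "?O = {}")
    case True
    then have "?B = {}" by blast
    then show ?thesis using True by (auto simp only: card.empty split: if_splits)
  next
    case False
    then show ?thesis using B[OF False] by auto
  qed
  ultimately show ?thesis using True by (simp only: if_True)
qed

text \<open>A set with both letters is monotone in at most one direction and then has two pivots for
  it. A constant nonempty set is monotone in both directions and has one pivot for each.\<close>

lemma card_pivots_both:
  assumes "I \<subseteq> {..<n}" "I \<noteq> {}"
  shows "card {i\<in>I. I - {i} \<subseteq> up_nbrs n P i} + card {i\<in>I. I - {i} \<subseteq> up_nbrs n (\<lambda>j. \<not> P j) i} =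
    (if up_on P I \<or> up_on (\<lambda>j. \<not> P j) I then 2 else 0)"
proof -
  have "up_on P I \<and> up_on (\<lambda>j. \<not> P j) I \<longleftrightarrow> (\<forall>i\<in>I. P i) \<or> (\<forall>i\<in>I. \<not> P i)"
    (is "?L \<longleftrightarrow> ?R")
  proof
    assume L: ?L
    have "P i = P j" if "i \<in> I" "j \<in> I" for i j
      using L that unfolding up_on_def by (cases i j rule: linorder_cases) auto
    then show ?R by blast
  qed (auto simp: up_on_def)
  then show ?thesis
    unfolding card_pivots[OF assms(1)] using assms(2) by auto
qed

lemma card_subsets_with_pivot:
  assumes "i < n" "k \<ge> 1"
  shows "card {I. I \<subseteq> {..<n} \<and> card I = k \<and> i \<in> I \<and> I - {i} \<subseteq> up_nbrs n P i} =
    card (up_nbrs n P i) choose (k - 1)"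
proof -
  let ?D = "up_nbrs n P i"
  have ni: "i \<notin> ?D" and D: "?D \<subseteq> {..<n}" unfolding up_nbrs_def by auto
  have "bij_betw (\<lambda>I. I - {i})
      {I. I \<subseteq> {..<n} \<and> card I = k \<and> i \<in> I \<and> I - {i} \<subseteq> ?D} {K. K \<subseteq> ?D \<and> card K = k - 1}"
  proof (rule bij_betw_byWitness[where f' = "insert i"])
    show "insert i ` {K. K \<subseteq> ?D \<and> card K = k - 1}
        \<subseteq> {I. I \<subseteq> {..<n} \<and> card I = k \<and> i \<in> I \<and> I - {i} \<subseteq> ?D}"
    proof clarify
      fix K assume K: "K \<subseteq> ?D" "card K = k - 1"
      then have "finite K" "i \<notin> K" using finite_subset[OF _ finite_up_nbrs] ni by auto
      then show "insert i K \<subseteq> {..<n} \<and> card (insert i K) = k \<and> i \<in> insert i K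
          \<and> insert i K - {i} \<subseteq> ?D"
        using K D assms by auto
    qed
  qed (use ni in auto)
  then show ?thesis
    by (simp add: bij_betw_same_card n_subsets)
qed

lemma double_count_monotone_sets:
  assumes "k \<ge> 1"
  shows "2 * card {I. I \<subseteq> {..<n} \<and> card I = k \<and> (up_on P I \<or> up_on (\<lambda>j. \<not> P j) I)} =
    (\<Sum>i<n. (card (up_nbrs n P i) choose (k - 1)) +
            (card (up_nbrs n (\<lambda>j. \<not> P j) i) choose (k - 1)))"
proof -
  define S where "S = {I. I \<subseteq> {..<n} \<and> card I = k}"
  have finS: "finite S" unfolding S_def by simp
  have *: "(\<Sum>i<n. card (up_nbrs n Q i) choose (k - 1)) =
      (\<Sum>I\<in>S. card {i\<in>I. I - {i} \<subseteq> up_nbrs n Q i})" for Q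
  proof -
    have "(\<Sum>i<n. card (up_nbrs n Q i) choose (k - 1)) =
        (\<Sum>i<n. card {I\<in>S. i \<in> I \<and> I - {i} \<subseteq> up_nbrs n Q i})"
      using card_subsets_with_pivot[OF _ assms, of _ n Q]
      by (intro sum.cong) (auto simp: S_def conj_ac)
    \<comment> \<open>Pairs of a set and one of its pivots are counted first by the pivot, then by
      the set.\<close>
    also have "\<dots> = (\<Sum>I\<in>S. card {i\<in>{..<n}. i \<in> I \<and> I - {i} \<subseteq> up_nbrs n Q i})"
      by (rule sum_multicount_gen) (use finS in auto)
    also have "\<dots> = (\<Sum>I\<in>S. card {i\<in>I. I - {i} \<subseteq> up_nbrs n Q i})"
      by (intro sum.cong refl arg_cong[where f = card]) (auto simp: S_def)
    finally show ?thesis .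
  qed
  have "(\<Sum>i<n. (card (up_nbrs n P i) choose (k - 1)) +
            (card (up_nbrs n (\<lambda>j. \<not> P j) i) choose (k - 1))) =
      (\<Sum>I\<in>S. if up_on P I \<or> up_on (\<lambda>j. \<not> P j) I then 2 else 0)"
    \<comment> \<open>The two directions are separated, each is turned into a sum over
      \<open>S\<close>, and they are merged again so that \<open>card_pivots_both\<close> applies to
      each set; \<open>k \<ge> 1\<close> makes the sets nonempty.\<close>
    unfolding sum.distrib * unfolding sum.distrib[symmetric]
    by (intro sum.cong refl card_pivots_both) (use assms in \<open>auto simp: S_def\<close>)
  also have "\<dots> = 2 * card {I\<in>S. up_on P I \<or> up_on (\<lambda>j. \<not> P j) I}"
    using finS by (simp add: sum.If_cases Int_def)
  finally show ?thesis by (simp add: S_def conj_ac)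
qed

section \<open>From binary words to sets of positions\<close>

lemma sorted_wrt_nths_iff:
  "sorted_wrt R (nths w I) \<longleftrightarrow>
    (\<forall>i j. i \<in> I \<longrightarrow> j \<in> I \<longrightarrow> i < j \<longrightarrow> j < length w \<longrightarrow> R (w ! i) (w ! j))"
proof (induction w rule: rev_induct)
  case (snoc x w)
  \<comment> \<open>Appending on the right keeps the old positions, so the only new comparisons are
    those with \<open>x\<close>.\<close>
  have "sorted_wrt R (nths (w @ [x]) I) \<longleftrightarrow> sorted_wrt R (nths w I) \<and>
      (length w \<in> I \<longrightarrow> (\<forall>i<length w. i \<in> I \<longrightarrow> R (w ! i) x))"
    by (auto simp: nths_append sorted_wrt_append set_nths)
  then show ?case
    unfolding snoc.IH by (auto simp: nth_append less_Suc_eq)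
qed simp

lemma monotone_word_nths_iff:
  assumes "w \<in> words 2 n" "I \<subseteq> {..<n}"
  shows "monotone_word (nths w I) \<longleftrightarrow>
    up_on (\<lambda>i. w ! i = 1) I \<or> up_on (\<lambda>i. \<not> w ! i = 1) I"
proof -
  have len: "length w = n" and bin: "\<And>i. i < n \<Longrightarrow> w ! i = 0 \<or> w ! i = 1"
    using assms(1) nth_mem[of _ w] unfolding words_def by fastforce+
  \<comment> \<open>On binary letters the order is implication between the statements that a letter
    is 1; its contrapositive handles the non-increasing case.\<close>
  have le: "w ! i \<le> w ! j \<longleftrightarrow> (w ! i = 1 \<longrightarrow> w ! j = 1)" if "i \<in> I" "j \<in> I" for i j
    using bin[of i] bin[of j] subsetD[OF assms(2)] that by force
  have "sorted_wrt (\<le>) (nths w I) \<longleftrightarrow> up_on (\<lambda>i. w ! i = 1) I"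
    unfolding sorted_wrt_nths_iff up_on_def len using assms(2) by (auto simp: le)
  moreover have "sorted_wrt (\<ge>) (nths w I) \<longleftrightarrow> up_on (\<lambda>i. \<not> w ! i = 1) I"
    unfolding sorted_wrt_nths_iff up_on_def len using assms(2) by (auto simp: le)
  ultimately show ?thesis unfolding monotone_word_def by simp
qed

lemma double_monotone_subwords:
  assumes "w \<in> words 2 n" "k \<ge> 1"
  shows "2 * monotone_subwords k w =
    (\<Sum>i<n. (card (up_nbrs n (\<lambda>i. w ! i = 1) i) choose (k - 1)) +
            (card (up_nbrs n (\<lambda>i. \<not> w ! i = 1) i) choose (k - 1)))"
proof -
  have "length w = n" using assms unfolding words_def by simp
  then have "monotone_subwords k w = card {I. I \<subseteq> {..<n} \<and> card I = k \<and>
      (up_on (\<lambda>i. w ! i = 1) I \<or> up_on (\<lambda>i. \<not> w ! i = 1) I)}"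
    unfolding monotone_subwords_def using monotone_word_nths_iff[OF assms(1)]
    by (intro arg_cong[where f = card]) (auto simp: atLeast0LessThan)
  then show ?thesis using double_count_monotone_sets[OF assms(2)] by simp
qed

section \<open>Convexity and the extremal alternating word\<close>

lemma binomial_convex:
  assumes "a \<le> (b :: nat)"
  shows "(a + t choose j) + (b choose j) \<le> (a choose j) + (b + t choose j)"
proof (cases j)
  case (Suc l)
  show ?thesis
  proof (induction t)
    case (Suc t)
    \<comment> \<open>By Pascal's rule these are the increments of the two sides when
      \<open>t\<close> grows by one.\<close>
    have "(a + t choose l) \<le> (b + t choose l)"
      using assms by (intro binomial_right_mono) simp
    then show ?case using Suc \<open>j = Suc l\<close> by simp
  qed simp
qed simp

lemma binomial_sum_balanced_le:
  "(((a + b) div 2) choose j) + ((a + b - (a + b) div 2) choose j) \<le> (a choose j) + (b choose j)"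
proof -
  have *: "(((a + b) div 2) choose j) + ((a + b - (a + b) div 2) choose j)
      \<le> (a choose j) + (b choose j)" if "a \<le> b" for a b :: nat
    \<comment> \<open>The shift raises \<open>a\<close> to the lower half of \<open>a + b\<close>,
      and raises the upper half to \<open>b\<close>.\<close>
    using binomial_convex[of a "a + b - (a + b) div 2" "(a + b) div 2 - a" j] that by simp
  show ?thesis
    using *[of a b] *[of b a] by (cases "a \<le> b") (simp_all add: add.commute)
qed

definition alternating :: "nat \<Rightarrow> nat list" where
  "alternating n = map (\<lambda>i. i mod 2) [0..<n]"

lemma alternating_in_words: "alternating n \<in> words 2 n"
  unfolding alternating_def words_def by auto

lemma card_up_nbrs_alternating:
  assumes "i < n"
  shows "card (up_nbrs n (\<lambda>j. alternating n ! j = 1) i) = n div 2"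
proof -
  have eq: "up_nbrs n (\<lambda>j. alternating n ! j = 1) i =
      {j. j < n \<and> (j < i \<and> even j \<or> i < j \<and> odd j)}"
    unfolding up_nbrs_def alternating_def by (auto simp: odd_iff_mod_2_eq_one)
  have "bij_betw (\<lambda>j. j div 2) {j. j < n \<and> (j < i \<and> even j \<or> i < j \<and> odd j)} {..<n div 2}"
  \<comment> \<open>Each pair of positions \<open>2 * q\<close>, \<open>2 * q + 1\<close> below
    \<open>n\<close> contributes exactly one element: the even one if it is before \<open>i\<close>,
    else the odd one. For odd \<open>n\<close> the unpaired position \<open>n - 1\<close> is even
    and not before \<open>i\<close>, so it is absent.\<close>
  proof (rule bij_betw_byWitness[where f' = "\<lambda>q. if 2 * q < i then 2 * q else 2 * q + 1"])
    show "(\<lambda>j. j div 2) ` {j. j < n \<and> (j < i \<and> even j \<or> i < j \<and> odd j)} \<subseteq> {..<n div 2}"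
      using assms by (auto elim!: evenE oddE)
  qed (use assms in \<open>auto elim!: evenE, presburger\<close>)
  then show ?thesis unfolding eq by (simp add: bij_betw_same_card)
qed

lemma double_monotone_subwords_ge:
  assumes "w \<in> words 2 n" "k \<ge> 1"
  shows "n * ((n div 2 choose (k - 1)) + ((n - 1 - n div 2) choose (k - 1)))
    \<le> 2 * monotone_subwords k w"
proof -
  have "(n div 2 choose (k - 1)) + ((n - 1 - n div 2) choose (k - 1)) \<le>
      (card (up_nbrs n (\<lambda>i. w ! i = 1) i) choose (k - 1)) +
      (card (up_nbrs n (\<lambda>i. \<not> w ! i = 1) i) choose (k - 1))" if "i < n" for i
  proof -
    \<comment> \<open>The halves of \<open>n - 1\<close> are renamed to the sizes of
      \<open>D i\<close> and \<open>E i\<close> in the alternating word, where \<open>D i\<close> is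
      the larger one.\<close>
    have "n - 1 - (n - 1) div 2 = n div 2" "(n - 1) div 2 = n - 1 - n div 2"
      using that by linarith+
    then show ?thesis
      using binomial_sum_balanced_le[of "card (up_nbrs n (\<lambda>i. w ! i = 1) i)"
          "card (up_nbrs n (\<lambda>i. \<not> w ! i = 1) i)" "k - 1"]
      unfolding card_up_nbrs_compl[OF that] by simp
  qed
  then have "(\<Sum>i<n. (n div 2 choose (k - 1)) + ((n - 1 - n div 2) choose (k - 1)))
      \<le> 2 * monotone_subwords k w"
    unfolding double_monotone_subwords[OF assms] by (intro sum_mono) simp
  then show ?thesis by simp
qed

lemma double_monotone_subwords_alternating:
  assumes "k \<ge> 1"
  shows "2 * monotone_subwords k (alternating n) =
    n * ((n div 2 choose (k - 1)) + ((n - 1 - n div 2) choose (k - 1)))"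
proof -
  have "(card (up_nbrs n (\<lambda>i. alternating n ! i = 1) i) choose (k - 1)) +
      (card (up_nbrs n (\<lambda>i. \<not> alternating n ! i = 1) i) choose (k - 1)) =
      (n div 2 choose (k - 1)) + ((n - 1 - n div 2) choose (k - 1))" if "i < n" for i
  proof -
    have "card (up_nbrs n (\<lambda>i. \<not> alternating n ! i = 1) i) = n - 1 - n div 2"
      using card_up_nbrs_compl[OF that, of "\<lambda>i. alternating n ! i = 1"]
        card_up_nbrs_alternating[OF that] by linarith
    then show ?thesis using card_up_nbrs_alternating[OF that] by simp
  qed
  then have "2 * monotone_subwords k (alternating n) =
      (\<Sum>i<n. (n div 2 choose (k - 1)) + ((n - 1 - n div 2) choose (k - 1)))"
    unfolding double_monotone_subwords[OF alternating_in_words assms] by (intro sum.cong) simp_all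
  then show ?thesis by simp
qed

text \<open>The alternating word attains the lower bound, so the minimum is known exactly for every
  \<open>n\<close>. For \<open>n < k\<close> both sides are 0, since division by 0 yields 0.\<close>

lemma min_density_2:
  assumes "k \<ge> 1"
  shows "min_density 2 k n = real n / 2 *
    (real (n div 2 choose (k - 1)) + real ((n - 1 - n div 2) choose (k - 1))) / real (n choose k)"
    (is "_ = ?r")
  unfolding min_density_def
proof (rule Min_eqI)
  have "finite {w. set w \<subseteq> {0..<2::nat} \<and> length w = n}"
    by (rule finite_lists_length_eq) simp
  then show "finite ((\<lambda>w. real (monotone_subwords k w) / real (n choose k)) ` words 2 n)"
    unfolding words_def by (simp add: conj_commute)
next
  fix y assume "y \<in> (\<lambda>w. real (monotone_subwords k w) / real (n choose k)) ` words 2 n"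
  then obtain w where w: "w \<in> words 2 n" "y = real (monotone_subwords k w) / real (n choose k)"
    by auto
  have "real (n * ((n div 2 choose (k - 1)) + ((n - 1 - n div 2) choose (k - 1))))
      \<le> real (2 * monotone_subwords k w)"
    using double_monotone_subwords_ge[OF w(1) assms] by (simp only: of_nat_le_iff)
  then show "?r \<le> y" unfolding w(2) by (intro divide_right_mono) (simp_all add: field_simps)
next
  have "real (2 * monotone_subwords k (alternating n)) =
      real (n * ((n div 2 choose (k - 1)) + ((n - 1 - n div 2) choose (k - 1))))"
    using double_monotone_subwords_alternating[OF assms] by simp
  then have "real (monotone_subwords k (alternating n)) = real n / 2 *
      (real (n div 2 choose (k - 1)) + real ((n - 1 - n div 2) choose (k - 1)))"
    by simp
  then have "?r = real (monotone_subwords k (alternating n)) / real (n choose k)"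
    by (simp only:)
  then show "?r \<in> (\<lambda>w. real (monotone_subwords k w) / real (n choose k)) ` words 2 n"
    using alternating_in_words by blast
qed

section \<open>Passing to the limit\<close>

lemma binomial_eq_prod_real: "real (m choose j) = (\<Prod>i<j. real m - real i) / fact j"
  by (simp add: binomial_gbinomial gbinomial_prod_rev atLeast0LessThan)

text \<open>The factorials cancel, leaving a product of \<open>j\<close> factors that each tend to
  \<open>c\<close>.\<close>

lemma tendsto_binomial_ratio:
  fixes a b :: "nat \<Rightarrow> nat"
  assumes "\<And>i. (\<lambda>n. (real (a n) - real i) / (real (b n) - real i)) \<longlonglongrightarrow> c"
  shows "(\<lambda>n. real (a n choose j) / real (b n choose j)) \<longlonglongrightarrow> c ^ j"
proof -
  have "real (a n choose j) / real (b n choose j) =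
      (\<Prod>i<j. (real (a n) - real i) / (real (b n) - real i))" for n
    by (simp add: binomial_eq_prod_real prod_dividef)
  moreover have "(\<lambda>n. \<Prod>i<j. (real (a n) - real i) / (real (b n) - real i)) \<longlonglongrightarrow> (\<Prod>i<j. c)"
    by (intro tendsto_prod assms)
  ultimately show ?thesis by simp
qed

lemma tendsto_half_ratio:
  fixes a :: "nat \<Rightarrow> nat"
  assumes "\<And>n. \<bar>real (a n) - real n / 2\<bar> \<le> 1"
  shows "(\<lambda>n. (real (a n) - real i) / (real (n - 1) - real i)) \<longlonglongrightarrow> 1 / 2"
proof -
  have *: "(\<lambda>n. (real n / 2 + c) / (real n - 1 - real i)) \<longlonglongrightarrow> 1 / 2" for c
  proof -
    let ?e = "-1 - real i"
    have "filterlim (\<lambda>n. ?e + real n) at_infinity sequentially"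
      by (intro filterlim_at_top_imp_at_infinity filterlim_tendsto_add_at_top[OF tendsto_const]
          filterlim_real_sequentially)
    \<comment> \<open>Splitting half of the denominator off the numerator leaves a constant over a
      divergent denominator.\<close>
    then have "(\<lambda>n. 1 / 2 + (c - ?e / 2) / (?e + real n)) \<longlonglongrightarrow> 1 / 2 + 0"
      by (intro tendsto_add tendsto_const tendsto_divide_0[OF tendsto_const])
    moreover have "\<forall>\<^sub>F n in sequentially. n \<ge> i + 2" by (rule eventually_ge_at_top)
    then have "\<forall>\<^sub>F n in sequentially. 1 / 2 + (c - ?e / 2) / (?e + real n)
        = (real n / 2 + c) / (real n - 1 - real i)"
    proof eventually_elim
      case (elim n)
      then have "real n - 1 - real i > 0" by linarith
      then show ?case by (simp add: field_simps)
    qed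
    ultimately show ?thesis by (auto intro: Lim_transform_eventually)
  qed
  show ?thesis
  \<comment> \<open>The bounds replace \<open>a n\<close> by \<open>n / 2\<close> minus or plus 1;
    for \<open>n \<ge> i + 2\<close> the denominator is positive.\<close>
  proof (rule tendsto_sandwich[OF _ _ *[of "-1 - real i"] *[of "1 - real i"]])
    have "\<forall>\<^sub>F n in sequentially. n \<ge> i + 2" by (rule eventually_ge_at_top)
    then show "\<forall>\<^sub>F n in sequentially. (real n / 2 + (-1 - real i)) / (real n - 1 - real i)
        \<le> (real (a n) - real i) / (real (n - 1) - real i)"
    proof eventually_elim
      case (elim n)
      then show ?case using assms[of n]
        by (simp add: of_nat_diff divide_right_mono abs_le_iff)
    qed
    have "\<forall>\<^sub>F n in sequentially. n \<ge> i + 2" by (rule eventually_ge_at_top)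
    then show "\<forall>\<^sub>F n in sequentially. (real (a n) - real i) / (real (n - 1) - real i)
        \<le> (real n / 2 + (1 - real i)) / (real n - 1 - real i)"
    proof eventually_elim
      case (elim n)
      then show ?case using assms[of n]
        by (simp add: of_nat_diff divide_right_mono abs_le_iff)
    qed
  qed
qed

lemma tendsto_min_density_2:
  assumes "k \<ge> 1"
  shows "(\<lambda>n. min_density 2 k n) \<longlonglongrightarrow> real k / 2 ^ (k - 1)"
proof -
  define j where "j = k - 1"
  have k: "k = Suc j" using assms unfolding j_def by simp
  have 1: "(\<lambda>n. real (n div 2 choose j) / real (n - 1 choose j)) \<longlonglongrightarrow> (1 / 2) ^ j"
    by (intro tendsto_binomial_ratio tendsto_half_ratio) linarith
  have 2: "(\<lambda>n. real (n - 1 - n div 2 choose j) / real (n - 1 choose j)) \<longlonglongrightarrow> (1 / 2) ^ j"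
    by (intro tendsto_binomial_ratio tendsto_half_ratio) linarith
  have "(\<lambda>n. real k / 2 * (real (n div 2 choose j) / real (n - 1 choose j) +
      real (n - 1 - n div 2 choose j) / real (n - 1 choose j)))
      \<longlonglongrightarrow> real k / 2 * ((1 / 2) ^ j + (1 / 2) ^ j)"
    by (intro tendsto_intros 1 2)
  also have "real k / 2 * ((1 / 2) ^ j + (1 / 2) ^ j) = real k / 2 ^ (k - 1)"
    unfolding j_def by (simp add: power_one_over)
  finally have lim: "(\<lambda>n. real k / 2 * (real (n div 2 choose j) / real (n - 1 choose j) +
      real (n - 1 - n div 2 choose j) / real (n - 1 choose j))) \<longlonglongrightarrow> real k / 2 ^ (k - 1)" .
  \<comment> \<open>Absorption, \<open>k * (n choose k) = n * (n - 1 choose k - 1)\<close>, removes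
    the factor \<open>n\<close> and explains the denominators \<open>n - 1 choose j\<close>. For
    \<open>n \<ge> k\<close> the binomials divided by are nonzero, which suffices for the
    limit.\<close>
  have eq: "min_density 2 k n = real k / 2 * (real (n div 2 choose j) / real (n - 1 choose j) +
      real (n - 1 - n div 2 choose j) / real (n - 1 choose j))" if "n \<ge> k" for n
  proof -
    obtain m where n: "n = Suc m" using \<open>n \<ge> k\<close> k by (cases n) auto
    have "real (Suc j) * real (Suc m choose Suc j) = real (Suc m) * real (m choose j)"
      using Suc_times_binomial[of j m] by (metis of_nat_mult)
    moreover have "(Suc m choose Suc j) > 0" "(m choose j) > 0" using that k n by auto
    ultimately have *: "real n / real (n choose k) = real k / real (m choose j)"
      unfolding n k by (simp add: field_simps del: binomial_Suc_Suc)
    have "min_density 2 k n = (real n / real (n choose k)) / 2 *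
        (real (n div 2 choose j) + real (n - 1 - n div 2 choose j))"
      unfolding min_density_2[OF assms] j_def by (simp add: field_simps)
    then show ?thesis unfolding * by (simp add: n add_divide_distrib distrib_left)
  qed
  show ?thesis
    by (rule Lim_transform_eventually[OF lim], rule eventually_sequentiallyI[of k])
      (simp only: eq)
qed

theorem theorem1p1:
  fixes k :: nat
  assumes "k \<ge> 2"
  shows "convergent (\<lambda>n. min_density 2 k n) \<and> limit_density 2 k = real k / 2 ^ (k - 1)"
proof -
  have "(\<lambda>n. min_density 2 k n) \<longlonglongrightarrow> real k / 2 ^ (k - 1)"
    using assms by (intro tendsto_min_density_2) simp
  then show ?thesis
    unfolding limit_density_def by (auto simp: convergentI limI)
qed

end
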